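(* Let $n\ge2$ and let $u,v\in\mathbb{M}_n(\mathbb{C})$ be unitary matrices. Then $$\cos\alpha\left(u\Delta^{(n)}u^*,v\Delta^{(n)}v^*\right)=\frac{n}{n-1}\left\|\,|u^*v|^{\circ2}\circ(u^*v)-\frac1n u^*v\,\right\|_{\mathrm{op}}.$$
   Context: $\Delta^{(n)}$ denotes the algebra of diagonal matrices in $\mathbb{M}_n(\mathbb{C})$; $\circ$ is the entrywise (Hadamard) product and $|w|^{\circ2}$ is the matrix with entries $|w_{ij}|^2$; $\|\cdot\|_{\mathrm{op}}$ is the operator norm. Interior angle (taken with respect to $E_0(X)=\frac1n\operatorname{Tr}(X)\mathbb{I}_n$): view $\mathbb{M}_n(\mathbb{C})$ as a Hilbert space with inner product $\langle X,Y\rangle_\tau=\frac1n\operatorname{Tr}(X^*Y)$, and let $\mathbb{M}_n(\mathbb{C})$ act on it by left multiplication. For a unital $C^*$-subalgebra $\mathcal{C}\subseteq\mathbb{M}_n(\mathbb{C})$ let $e_{\mathcal{C}}\in\mathcal{B}(\mathbb{M}_n(\mathbb{C}))$ be the Jones projection $X\mapsto E_{\mathcal{C}}(X)$, where $E_{\mathcal{C}}$ is the trace-preserving conditional expectation onto $\mathcal{C}$ (equivalently, $e_{\mathcal{C}}$ is the orthogonal projection onto $\mathcal{C}$), and let $e_1:=e_{\mathbb{C}\mathbb{I}_n}$. Let $\tilde{E}:\mathcal{B}(\mathbb{M}_n(\mathbb{C}))\to\mathbb{M}_n(\mathbb{C})$ be the dual conditional expectation, i.e. the linear map determined by $\tilde{E}(xe_1y)=\frac1{n^2}xy$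 for $x,y\in\mathbb{M}_n(\mathbb{C})$. (Identifying $A\otimes B$ with the operator $X\mapsto AXB^T$, one has $\tilde{E}(A\otimes B)=\frac1n\operatorname{Tr}(B)A$.) For $S,T\in\mathcal{B}(\mathbb{M}_n(\mathbb{C}))$ put $\langle S,T\rangle:=\tilde{E}(S^*T)$ and $\|S\|_{\sim}:=\|\tilde{E}(S^*S)\|^{1/2}$, with the operator norm on $\mathbb{M}_n(\mathbb{C})$. For unital $C^*$-subalgebras $\mathcal{C},\mathcal{D}\neq\mathbb{C}\mathbb{I}_n$, $\alpha(\mathcal{C},\mathcal{D})$ is the unique element of $[0,\pi/2]$ with $$\cos\alpha(\mathcal{C},\mathcal{D})=\frac{\|\langle e_{\mathcal{C}}-e_1,\,e_{\mathcal{D}}-e_1\rangle\|}{\|e_{\mathcal{C}}-e_1\|_{\sim}\,\|e_{\mathcal{D}}-e_1\|_{\sim}}.$$ *)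

theory Defs
  imports "HOL-Analysis.Analysis"
begin

text \<open>The algebra $\mathbb{M}_n(\mathbb{C})$ is the type \<open>complex^'n^'n\<close>, with \<open>n = CARD('n)\<close>.
  The library norm on this type is not the operator norm; the latter is \<open>opnorm\<close> below,
  the operator norm with respect to the Euclidean norm on \<open>complex^'n\<close>.\<close>

definition cscale :: "complex \<Rightarrow> complex^'n^'n \<Rightarrow> complex^'n^'n"  (infixr \<open>*\<^sub>C\<close> 75)
  where "c *\<^sub>C A = (\<chi> i j. c * A $ i $ j)"

definition ctransp :: "complex^'n^'n \<Rightarrow> complex^'n^'n"
  where "ctransp A = (\<chi> i j. cnj (A $ j $ i))"

definition unitary :: "complex^'n^'n \<Rightarrow> bool"
  where "unitary u \<longleftrightarrow> ctransp u ** u = mat 1 \<and> u ** ctransp u = mat 1"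

definition positive_matrix :: "complex^'n^'n \<Rightarrow> bool"
  where "positive_matrix A \<longleftrightarrow> (\<exists>B. A = ctransp B ** B)"

definition hadamard :: "complex^'n^'n \<Rightarrow> complex^'n^'n \<Rightarrow> complex^'n^'n"
  where "hadamard A B = (\<chi> i j. A $ i $ j * B $ i $ j)"

definition abs_square :: "complex^'n^'n \<Rightarrow> complex^'n^'n"
  where "abs_square A = (\<chi> i j. complex_of_real ((cmod (A $ i $ j))\<^sup>2))"

definition opnorm :: "complex^'n^'n \<Rightarrow> real"
  where "opnorm A = onorm (\<lambda>x. A *v x)"

definition tau_inner :: "complex^'n^'n \<Rightarrow> complex^'n^'n \<Rightarrow> complex"
  where "tau_inner X Y = trace (ctransp X ** Y) / of_nat CARD('n)"

definition unital_cstar_subalgebra :: "(complex^'n^'n) set \<Rightarrow> bool"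
  where "unital_cstar_subalgebra C \<longleftrightarrow>
    mat 1 \<in> C \<and>
    (\<forall>a\<in>C. \<forall>b\<in>C. a + b \<in> C \<and> a ** b \<in> C) \<and>
    (\<forall>c. \<forall>a\<in>C. c *\<^sub>C a \<in> C) \<and>
    (\<forall>a\<in>C. ctransp a \<in> C)"

definition scalar_matrices :: "(complex^'n^'n) set"
  where "scalar_matrices = range (\<lambda>c. mat c)"

definition diagonal_matrices :: "(complex^'n^'n) set"
  where "diagonal_matrices = {A. \<forall>i j. i \<noteq> j \<longrightarrow> A $ i $ j = 0}"

definition conjugate_set :: "complex^'n^'n \<Rightarrow> (complex^'n^'n) set \<Rightarrow> (complex^'n^'n) set"
  where "conjugate_set u C = (\<lambda>a. u ** a ** ctransp u) ` C"

definition mat_operators :: "(complex^'n^'n \<Rightarrow> complex^'n^'n) set"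
  where "mat_operators =
    {S. (\<forall>X Y. S (X + Y) = S X + S Y) \<and> (\<forall>c X. S (c *\<^sub>C X) = c *\<^sub>C S X)}"

definition op_adjoint ::
  "(complex^'n^'n \<Rightarrow> complex^'n^'n) \<Rightarrow> (complex^'n^'n \<Rightarrow> complex^'n^'n)"
  where "op_adjoint S = (THE T. \<forall>X Y. tau_inner (T X) Y = tau_inner X (S Y))"

definition trace_cond_exp ::
  "(complex^'n^'n) set \<Rightarrow> (complex^'n^'n \<Rightarrow> complex^'n^'n) \<Rightarrow> bool"
  where "trace_cond_exp C E \<longleftrightarrow>
    E \<in> mat_operators \<and>
    (\<forall>X. E X \<in> C) \<and>
    (\<forall>c\<in>C. E c = c) \<and>
    (\<forall>X. positive_matrix X \<longrightarrow> positive_matrix (E X)) \<and>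
    (\<forall>a\<in>C. \<forall>b\<in>C. \<forall>X. E (a ** X ** b) = a ** E X ** b) \<and>
    (\<forall>X. trace (E X) = trace X)"

definition jones_proj :: "(complex^'n^'n) set \<Rightarrow> (complex^'n^'n \<Rightarrow> complex^'n^'n)"
  where "jones_proj C = (THE E. trace_cond_exp C E)"

definition jones_e1 :: "complex^'n^'n \<Rightarrow> complex^'n^'n"
  where "jones_e1 = jones_proj scalar_matrices"

text \<open>Matrices act by left multiplication, so $x e_1 y$ is the operator
  \<open>\<lambda>X. x ** jones_e1 (y ** X)\<close>.  The operators of this form span \<open>mat_operators\<close>.
  As HOL functions are total, the value off \<open>mat_operators\<close> is fixed by \<open>extensional\<close>.\<close>

definition is_dual_cond_exp ::
  "((complex^'n^'n \<Rightarrow> complex^'n^'n) \<Rightarrow> complex^'n^'n) \<Rightarrow> bool"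
  where "is_dual_cond_exp F \<longleftrightarrow>
    F \<in> extensional mat_operators \<and>
    (\<forall>S\<in>mat_operators. \<forall>T\<in>mat_operators. F (\<lambda>X. S X + T X) = F S + F T) \<and>
    (\<forall>c. \<forall>S\<in>mat_operators. F (\<lambda>X. c *\<^sub>C S X) = c *\<^sub>C F S) \<and>
    (\<forall>x y. F (\<lambda>X. x ** jones_e1 (y ** X)) = (1 / (of_nat CARD('n))\<^sup>2) *\<^sub>C (x ** y))"

definition dual_cond_exp :: "(complex^'n^'n \<Rightarrow> complex^'n^'n) \<Rightarrow> complex^'n^'n"
  where "dual_cond_exp = (THE F. is_dual_cond_exp F)"

definition op_inner ::
  "(complex^'n^'n \<Rightarrow> complex^'n^'n) \<Rightarrow> (complex^'n^'n \<Rightarrow> complex^'n^'n) \<Rightarrow> complex^'n^'n"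
  where "op_inner S T = dual_cond_exp (op_adjoint S \<circ> T)"

definition op_norm_tilde :: "(complex^'n^'n \<Rightarrow> complex^'n^'n) \<Rightarrow> real"
  where "op_norm_tilde S = sqrt (opnorm (op_inner S S))"

definition jones_diff :: "(complex^'n^'n) set \<Rightarrow> (complex^'n^'n \<Rightarrow> complex^'n^'n)"
  where "jones_diff C = (\<lambda>X. jones_proj C X - jones_e1 X)"

text \<open>Intended for \<open>C\<close> and \<open>D\<close> satisfying \<open>unital_cstar_subalgebra\<close> and different from
  \<open>scalar_matrices\<close>; otherwise the value is junk.\<close>

definition interior_angle :: "(complex^'n^'n) set \<Rightarrow> (complex^'n^'n) set \<Rightarrow> real"
  where "interior_angle C D =
    (THE a. a \<in> {0..pi/2} \<and>
       cos a = opnorm (op_inner (jones_diff C) (jones_diff D)) /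
               (op_norm_tilde (jones_diff C) * op_norm_tilde (jones_diff D)))"

text \<open>Sanity lemmas: the definite descriptions defining \<open>jones_proj\<close> (for the algebras of interest),
  \<open>op_adjoint\<close> (when an adjoint exists) and \<open>dual_cond_exp\<close> denote, and \<open>conjugate_set u diagonal_matrices\<close>
  lies in the intended domain of \<open>interior_angle\<close>.\<close>

lemma ctransp_ctransp [simp]: "ctransp (ctransp A) = A"
  by (simp add: ctransp_def vec_eq_iff)

lemma ctransp_mult: "ctransp (A ** B) = ctransp B ** ctransp A"
  by (simp add: ctransp_def vec_eq_iff matrix_matrix_mult_def mult.commute)

lemma trace_cscale: "trace (c *\<^sub>C A) = c * trace A"
  by (simp add: trace_def cscale_def sum_distrib_left)

lemma cscale_mult_left: "(c *\<^sub>C A) ** B = c *\<^sub>C (A ** B)"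
  by (simp add: cscale_def vec_eq_iff matrix_matrix_mult_def sum_distrib_left mult.assoc)

lemma cscale_mult_right: "A ** (c *\<^sub>C B) = c *\<^sub>C (A ** B)"
  by (simp add: cscale_def vec_eq_iff matrix_matrix_mult_def sum_distrib_left mult.left_commute)

lemma mat_mult_left: "mat c ** A = c *\<^sub>C A"
  by (simp add: vec_eq_iff matrix_matrix_mult_def mat_def cscale_def if_distrib [of "\<lambda>x. x * _"]
      cong: if_cong)

lemma mat_mult_right: "A ** mat c = c *\<^sub>C A"
  by (simp add: vec_eq_iff matrix_matrix_mult_def mat_def cscale_def if_distrib [of "\<lambda>x. _ * x"]
      mult.commute cong: if_cong)

lemma cscale_add: "c *\<^sub>C (A + B) = c *\<^sub>C A + c *\<^sub>C B"
  by (simp add: cscale_def vec_eq_iff algebra_simps)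

lemma mult_add_left: "(A + B) ** C = A ** C + B ** (C :: complex^'n^'n)"
  by (simp add: vec_eq_iff matrix_matrix_mult_def sum.distrib algebra_simps)

lemma mult_diff_left: "(A - B) ** C = A ** C - B ** (C :: complex^'n^'n)"
  by (simp add: vec_eq_iff matrix_matrix_mult_def sum_subtractf algebra_simps)

lemma mult_diff_right: "A ** (B - C) = A ** B - A ** (C :: complex^'n^'n)"
  by (simp add: vec_eq_iff matrix_matrix_mult_def sum_subtractf algebra_simps)

lemma trace_ctransp_mult: "trace (ctransp Y ** Y) = (\<Sum>i\<in>UNIV. \<Sum>k\<in>UNIV. of_real ((cmod (Y $ k $ i))\<^sup>2))"
  by (simp only: trace_def ctransp_def matrix_matrix_mult_def vec_lambda_beta
      complex_norm_square mult.commute)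

lemma trace_ctransp_mult_zero:
  assumes "trace (ctransp Y ** Y) = 0"
  shows "Y = 0"
proof -
  have "of_real (\<Sum>i\<in>UNIV. \<Sum>k\<in>UNIV. (cmod (Y $ k $ i))\<^sup>2) = (0::complex)"
    using assms unfolding trace_ctransp_mult by simp
  then have "(\<Sum>i\<in>UNIV. \<Sum>k\<in>UNIV. (cmod (Y $ k $ i))\<^sup>2) = 0"
    by (simp only: of_real_eq_0_iff)
  then have "\<forall>i. \<forall>k. (cmod (Y $ k $ i))\<^sup>2 = 0"
    by (simp add: sum_nonneg_eq_0_iff sum_nonneg)
  then show ?thesis
    by (simp add: vec_eq_iff)
qed

lemma unital_cstar_subalgebra_conjugate_diagonal:
  assumes "unitary u"
  shows "unital_cstar_subalgebra (conjugate_set u diagonal_matrices)"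
proof -
  have uu: "ctransp u ** u = mat 1" "u ** ctransp u = mat 1"
    using assms by (auto simp: unitary_def)
  have D1: "mat 1 \<in> diagonal_matrices"
    by (simp add: diagonal_matrices_def mat_def)
  have Dadd: "a + b \<in> diagonal_matrices" if "a \<in> diagonal_matrices" "b \<in> diagonal_matrices"
    for a b :: "complex^'n^'n"
    using that by (simp add: diagonal_matrices_def)
  have Dmul: "a ** b \<in> diagonal_matrices" if "a \<in> diagonal_matrices" "b \<in> diagonal_matrices"
    for a b :: "complex^'n^'n"
    using that unfolding diagonal_matrices_def matrix_matrix_mult_def
    by (auto intro!: sum.neutral) (metis)
  have Dsc: "c *\<^sub>C a \<in> diagonal_matrices" if "a \<in> diagonal_matrices" for a :: "complex^'n^'n" and c
    using that by (simp add: diagonal_matrices_def cscale_def)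
  have Dct: "ctransp a \<in> diagonal_matrices" if "a \<in> diagonal_matrices" for a :: "complex^'n^'n"
    using that by (auto simp: diagonal_matrices_def ctransp_def)
  have cmul: "(u ** a ** ctransp u) ** (u ** b ** ctransp u) = u ** (a ** b) ** ctransp u" for a b
    by (metis uu(1) matrix_mul_assoc matrix_mul_lid)
  have cadd: "u ** a ** ctransp u + u ** b ** ctransp u = u ** (a + b) ** ctransp u" for a b
    by (simp add: matrix_add_ldistrib mult_add_left)
  have csc: "c *\<^sub>C (u ** a ** ctransp u) = u ** (c *\<^sub>C a) ** ctransp u" for a c
    by (simp add: cscale_mult_left cscale_mult_right)
  have cct: "ctransp (u ** a ** ctransp u) = u ** ctransp a ** ctransp u" for a
    by (simp add: ctransp_mult matrix_mul_assoc)
  have "mat 1 \<in> conjugate_set u diagonal_matrices"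
    using D1 uu unfolding conjugate_set_def by (auto intro!: image_eqI [where x = "mat 1"])
  then show ?thesis
    unfolding unital_cstar_subalgebra_def conjugate_set_def
    by (auto simp: cmul cadd csc cct Dadd Dmul Dsc Dct)
qed

lemma conjugate_diagonal_neq_scalar:
  fixes u :: "complex^'n^'n"
  assumes "unitary u" "CARD('n) \<ge> 2"
  shows "conjugate_set u diagonal_matrices \<noteq> scalar_matrices"
proof
  assume eq: "conjugate_set u diagonal_matrices = scalar_matrices"
  have uu: "ctransp u ** u = mat 1" "u ** ctransp u = mat 1"
    using assms by (auto simp: unitary_def)
  obtain p q :: 'n where pq: "p \<noteq> q"
    using assms(2) by (metis card_2_iff' ex_card top_greatest insertI1 numeral_2_eq_2 card_le_Suc0_iff_eq finite
      not_less_eq_eq)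
  define d :: "complex^'n^'n" where "d = (\<chi> i j. if i = p \<and> j = p then 1 else 0)"
  have "d \<in> diagonal_matrices"
    by (simp add: d_def diagonal_matrices_def)
  then obtain c where "u ** d ** ctransp u = mat c"
    using eq unfolding conjugate_set_def scalar_matrices_def by blast
  then have "ctransp u ** (u ** d ** ctransp u) ** u = ctransp u ** mat c ** u"
    by simp
  then have "d = mat c"
    by (metis uu matrix_mul_assoc matrix_mul_lid matrix_mul_rid mat_mult_left mat_mult_right cscale_mult_left)
  then have "d $ p $ p = d $ q $ q"
    by (simp add: mat_def)
  then show False
    using pq by (simp add: d_def)
qed

lemma trace_cond_exp_unique:
  assumes C: "unital_cstar_subalgebra C" and E: "trace_cond_exp C E" and F: "trace_cond_exp C F"
  shows "E = F"
proof
  fix X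
  have c1: "mat 1 \<in> C"
    using C by (simp add: unital_cstar_subalgebra_def)
  have tr: "trace (c ** G X) = trace (c ** X)" if "trace_cond_exp C G" "c \<in> C" for c G
    using that c1 unfolding trace_cond_exp_def by (metis matrix_mul_rid)
  define Z where "Z = E X - F X"
  have "E X + (- 1) *\<^sub>C F X \<in> C"
    using C E F by (simp add: unital_cstar_subalgebra_def trace_cond_exp_def)
  moreover have "E X + (- 1) *\<^sub>C F X = Z"
    by (simp add: Z_def cscale_def vec_eq_iff)
  ultimately have "ctransp Z \<in> C"
    using C by (simp add: unital_cstar_subalgebra_def)
  then have "trace (ctransp Z ** E X) = trace (ctransp Z ** F X)"
    using tr E F by metis
  then have "trace (ctransp Z ** Z) = 0"
    by (simp add: Z_def mult_diff_right trace_sub)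
  then show "E X = F X"
    using trace_ctransp_mult_zero [of Z] by (simp add: Z_def)
qed

lemma jones_proj_eqI:
  assumes "unital_cstar_subalgebra C" "trace_cond_exp C E"
  shows "jones_proj C = E"
  unfolding jones_proj_def
  using assms trace_cond_exp_unique by (metis the_equality)

lemma trace_cond_exp_scalar:
  "trace_cond_exp (scalar_matrices :: (complex^'n^'n) set) (\<lambda>X. mat (trace X / of_nat CARD('n)))"
proof -
  have pos: "positive_matrix (mat (trace X / of_nat CARD('n)) :: complex^'n^'n)" if X: "positive_matrix X"
    for X :: "complex^'n^'n"
  proof -
    obtain Y where Y: "X = ctransp Y ** Y"
      using X by (auto simp: positive_matrix_def)
    define r where "r = (\<Sum>i\<in>UNIV. \<Sum>k\<in>UNIV. (cmod (Y $ k $ i))\<^sup>2) / real CARD('n)"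
    have r0: "r \<ge> 0"
      by (simp add: r_def sum_nonneg)
    have "trace X / of_nat CARD('n) = of_real r"
      unfolding Y trace_ctransp_mult r_def by simp
    moreover have "(of_real r :: complex) = cnj (of_real (sqrt r)) * of_real (sqrt r)"
      using r0 by (simp flip: of_real_mult)
    moreover have "mat (cnj s * s) = ctransp (mat s) ** (mat s :: complex^'n^'n)" for s
      by (simp only: mat_mult_right) (simp add: vec_eq_iff ctransp_def mat_def cscale_def)
    ultimately show ?thesis
      unfolding positive_matrix_def by metis
  qed
  have "(\<lambda>X::complex^'n^'n. mat (trace X / of_nat CARD('n))) \<in> mat_operators"
    by (simp add: mat_operators_def trace_add trace_cscale)
      (simp add: vec_eq_iff mat_def cscale_def add_divide_distrib)
  then show ?thesis
    unfolding trace_cond_exp_def scalar_matrices_def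
    by (auto simp: pos mat_mult_left mat_mult_right trace_cscale)
      (auto simp: trace_def mat_def cscale_def vec_eq_iff)
qed

lemma unital_cstar_subalgebra_scalar:
  "unital_cstar_subalgebra (scalar_matrices :: (complex^'n^'n) set)"
proof -
  have *: "mat a + mat b = (mat (a + b) :: complex^'n^'n)"
    "mat a ** mat b = (mat (a * b) :: complex^'n^'n)"
    "a *\<^sub>C mat b = (mat (a * b) :: complex^'n^'n)"
    "ctransp (mat a) = (mat (cnj a) :: complex^'n^'n)"
    for a b :: complex
    by (simp_all add: mat_mult_left) (simp_all add: vec_eq_iff mat_def cscale_def ctransp_def)
  show ?thesis
    unfolding unital_cstar_subalgebra_def scalar_matrices_def
    by (auto simp: *)
qed

lemma jones_e1_eq: "jones_e1 = (\<lambda>X::complex^'n^'n. mat (trace X / of_nat CARD('n)))"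
  unfolding jones_e1_def
  by (rule jones_proj_eqI [OF unital_cstar_subalgebra_scalar trace_cond_exp_scalar])

lemma trace_cond_exp_conjugate_diagonal:
  fixes u :: "complex^'n^'n"
  assumes "unitary u"
  shows "trace_cond_exp (conjugate_set u diagonal_matrices)
    (\<lambda>X. u ** (\<chi> i j. if i = j then (ctransp u ** X ** u) $ i $ i else 0) ** ctransp u)"
proof -
  have uu: "ctransp u ** u = mat 1" "u ** ctransp u = mat 1"
    using assms by (auto simp: unitary_def)
  define D :: "complex^'n^'n \<Rightarrow> complex^'n^'n" where "D A = (\<chi> i j. if i = j then A $ i $ i else 0)" for A
  define E where "E X = u ** D (ctransp u ** X ** u) ** ctransp u" for X
  have c1: "ctransp u ** (u ** A ** ctransp u) ** u = A" for A
    by (metis uu(1) matrix_mul_assoc matrix_mul_lid matrix_mul_rid)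
  have c2: "(u ** a ** ctransp u) ** (u ** b ** ctransp u) = u ** (a ** b) ** ctransp u" for a b
    by (metis uu(1) matrix_mul_assoc matrix_mul_lid)
  have c3: "trace (u ** A ** ctransp u) = trace A" for A
    by (metis uu(1) trace_mul_sym matrix_mul_assoc matrix_mul_lid)
  have c4: "trace (ctransp u ** A ** u) = trace A" for A
    by (metis uu(2) trace_mul_sym matrix_mul_assoc matrix_mul_lid)
  have Dd: "D A \<in> diagonal_matrices" for A
    by (simp add: D_def diagonal_matrices_def)
  have Did: "D d = d" if "d \<in> diagonal_matrices" for d
    using that by (auto simp: D_def diagonal_matrices_def vec_eq_iff)
  have Dtr: "trace (D A) = trace A" for A
    by (simp add: D_def trace_def)
  have bm_aux: "(D d ** X) $ i $ j = d $ i $ i * X $ i $ j" "(X ** D d) $ i $ j = X $ i $ j * d $ j $ j"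
    for d X i j
    by (simp_all add: D_def matrix_matrix_mult_def if_distrib [of "\<lambda>x. x * _"]
        if_distrib [of "\<lambda>x. _ * x"] cong: if_cong)
  have "D (D a ** X ** D b) $ i $ j = (D a ** D X ** D b) $ i $ j" for a b X i j
    by (cases "i = j") (simp_all add: bm_aux(2), simp_all add: D_def [of "_ ** _"] D_def [of X] bm_aux,
        simp_all add: D_def)
  then have "D (D a ** X ** D b) = D a ** D X ** D b" for a b X
    by (simp add: vec_eq_iff)
  then have Dbm: "D (a ** X ** b) = a ** D X ** b"
    if "a \<in> diagonal_matrices" "b \<in> diagonal_matrices" for a b X
    using that Did by metis
  have lin: "E \<in> mat_operators"
  proof -
    have "D (A + B) = D A + D B" "D (c *\<^sub>C A) = c *\<^sub>C D A" for A B c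
      by (simp_all add: D_def cscale_def vec_eq_iff)
    then show ?thesis
      by (simp add: mat_operators_def E_def matrix_add_ldistrib mult_add_left
          cscale_mult_left cscale_mult_right)
  qed
  have bm: "E (a ** X ** b) = a ** E X ** b"
    if mem: "a \<in> conjugate_set u diagonal_matrices" "b \<in> conjugate_set u diagonal_matrices" for a b X
  proof -
    obtain a' b' where ab: "a = u ** a' ** ctransp u" "b = u ** b' ** ctransp u"
      "a' \<in> diagonal_matrices" "b' \<in> diagonal_matrices"
      using mem unfolding conjugate_set_def by blast
    have "ctransp u ** (a ** X ** b) ** u = a' ** (ctransp u ** X ** u) ** b'"
      unfolding ab by (metis uu(1) matrix_mul_assoc matrix_mul_lid matrix_mul_rid)
    then show ?thesis
      unfolding E_def using Dbm ab by (simp add: c2)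
  qed
  have pos: "positive_matrix (E X)" if X: "positive_matrix X" for X
  proof -
    obtain Y where Y: "X = ctransp Y ** Y"
      using X by (auto simp: positive_matrix_def)
    define Z where "Z = Y ** u"
    define r where "r i = (\<Sum>k\<in>UNIV. (cmod (Z $ k $ i))\<^sup>2)" for i
    define W :: "complex^'n^'n" where "W = (\<chi> i j. if i = j then of_real (sqrt (r i)) else 0)"
    have XZ: "ctransp u ** X ** u = ctransp Z ** Z"
      by (simp add: Y Z_def ctransp_mult matrix_mul_assoc)
    have ZZ: "(ctransp Z ** Z) $ i $ i = of_real (r i)" for i
      by (simp only: ctransp_def matrix_matrix_mult_def vec_lambda_beta r_def of_real_sum
          complex_norm_square mult.commute)
    have DW: "D W = W" and cW: "ctransp W = W"
      by (auto simp: D_def W_def ctransp_def vec_eq_iff)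
    have WW: "(W ** W) $ i $ j = (if i = j then of_real (r i) else 0)" for i j
    proof -
      have "r i \<ge> 0"
        by (simp add: r_def sum_nonneg)
      then show ?thesis
        using bm_aux(1) [of W W i j] \<open>D W = W\<close> by (cases "i = j") (simp_all add: W_def flip: of_real_mult)
    qed
    have Dij: "D (ctransp Z ** Z) $ i $ j = (W ** W) $ i $ j" for i j
      by (simp add: WW D_def [of "ctransp Z ** Z"] ZZ)
    have "D (ctransp u ** X ** u) = ctransp W ** W"
      unfolding XZ cW by (simp only: vec_eq_iff Dij) simp
    then have "E X = ctransp (W ** ctransp u) ** (W ** ctransp u)"
      by (simp add: E_def ctransp_mult matrix_mul_assoc)
    then show ?thesis
      unfolding positive_matrix_def by blast
  qed
  have "trace_cond_exp (conjugate_set u diagonal_matrices) E"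
    unfolding trace_cond_exp_def
    using lin pos bm Dd Did c1 c3 c4 Dtr
    by (auto simp: conjugate_set_def E_def)
  then show ?thesis
    unfolding E_def D_def .
qed

lemma op_adjoint_unique:
  assumes "\<forall>X Y. tau_inner (T X) Y = tau_inner X (S Y)"
  shows "op_adjoint S = T"
  unfolding op_adjoint_def
proof (rule the_equality [where P = "\<lambda>T. \<forall>X Y. tau_inner (T X) Y = tau_inner X (S Y)", OF assms])
  fix T' assume T': "\<forall>X Y. tau_inner (T' X) Y = tau_inner X (S Y)"
  show "T' = T"
  proof
    fix X
    define Z where "Z = T' X - T X"
    have "tau_inner (T' X) Z = tau_inner (T X) Z"
      using T' assms by simp
    then have "trace (ctransp (T' X) ** Z) = trace (ctransp (T X) ** Z)"
      by (simp add: tau_inner_def)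
    moreover have "ctransp Z = ctransp (T' X) - ctransp (T X)"
      by (simp add: Z_def ctransp_def vec_eq_iff)
    ultimately have "trace (ctransp Z ** Z) = 0"
      by (simp add: mult_diff_left trace_sub)
    then show "T' X = T X"
      using trace_ctransp_mult_zero [of Z] by (simp add: Z_def)
  qed
qed

lemma ex_dual_cond_exp:
  "is_dual_cond_exp (restrict (\<lambda>S. \<chi> i j. (\<Sum>k\<in>UNIV. S (\<chi> a b. if a = j \<and> b = k then 1 else 0) $ i $ k)
      / of_nat CARD('n)) mat_operators :: (complex^'n^'n \<Rightarrow> complex^'n^'n) \<Rightarrow> _)"
  (is "is_dual_cond_exp (restrict ?F _)")
proof -
  let ?U = "\<lambda>j k. (\<chi> a b. if a = j \<and> b = k then 1 else 0) :: complex^'n^'n"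
  have add: "(\<lambda>X. S X + T X) \<in> mat_operators"
    if "S \<in> mat_operators" "T \<in> mat_operators" for S T :: "complex^'n^'n \<Rightarrow> complex^'n^'n"
    using that by (simp add: mat_operators_def cscale_add)
  have sc: "(\<lambda>X. c *\<^sub>C S X) \<in> mat_operators"
    if "S \<in> mat_operators" for c and S :: "complex^'n^'n \<Rightarrow> complex^'n^'n"
    using that by (auto simp: mat_operators_def cscale_def vec_eq_iff algebra_simps)
  have e1: "jones_e1 \<in> (mat_operators :: (complex^'n^'n \<Rightarrow> _) set)"
    using trace_cond_exp_scalar unfolding jones_e1_eq trace_cond_exp_def by blast
  have rk: "(\<lambda>X. x ** jones_e1 (y ** X)) \<in> mat_operators" for x y :: "complex^'n^'n"
    using e1 by (simp add: mat_operators_def matrix_add_ldistrib cscale_mult_right)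
  have tr: "trace (y ** ?U j k) = y $ k $ j" for y j k
  proof -
    have "(y ** ?U j k) $ i $ i = (if i = k then y $ i $ j else 0)" for i
      by (auto simp: matrix_matrix_mult_def if_distrib [of "\<lambda>x. _ * x"] cong: if_cong)
    then show ?thesis
      by (simp add: trace_def)
  qed
  have "?F (\<lambda>X. x ** jones_e1 (y ** X)) = (1 / (of_nat CARD('n))\<^sup>2) *\<^sub>C (x ** y)" for x y
    by (simp only: jones_e1_eq mat_mult_right tr cscale_def vec_lambda_beta)
      (simp add: vec_eq_iff matrix_matrix_mult_def power2_eq_square sum_divide_distrib
        sum_distrib_left mult.commute)
  then show ?thesis
    unfolding is_dual_cond_exp_def
    by (auto simp: add sc rk)
      (simp_all add: vec_eq_iff cscale_def sum.distrib add_divide_distrib sum_distrib_left)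
qed

lemma is_dual_cond_exp_unique:
  fixes F G :: "(complex^'n^'n \<Rightarrow> complex^'n^'n) \<Rightarrow> complex^'n^'n"
  assumes F: "is_dual_cond_exp F" and G: "is_dual_cond_exp G"
  shows "F = G"
proof (rule extensionalityI [where A = mat_operators])
  show "F \<in> extensional mat_operators" "G \<in> extensional mat_operators"
    using F G by (auto simp: is_dual_cond_exp_def)
  fix S :: "complex^'n^'n \<Rightarrow> complex^'n^'n"
  assume S: "S \<in> mat_operators"
  let ?U = "\<lambda>j k. (\<chi> a b. if a = j \<and> b = k then 1 else 0) :: complex^'n^'n"
  let ?R = "\<lambda>j k X. (of_nat CARD('n) *\<^sub>C S (?U j k)) ** jones_e1 (?U k j ** X)"
  have e1: "jones_e1 \<in> (mat_operators :: (complex^'n^'n \<Rightarrow> _) set)"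
    using trace_cond_exp_scalar unfolding jones_e1_eq trace_cond_exp_def by blast
  have rk: "(\<lambda>X. x ** jones_e1 (y ** X)) \<in> mat_operators" for x y :: "complex^'n^'n"
    using e1 by (simp add: mat_operators_def matrix_add_ldistrib cscale_mult_right)
  have add: "(\<lambda>X. S X + T X) \<in> mat_operators"
    if "S \<in> mat_operators" "T \<in> mat_operators" for S T :: "complex^'n^'n \<Rightarrow> complex^'n^'n"
    using that by (simp add: mat_operators_def cscale_add)
  have zero: "(\<lambda>X. 0) \<in> mat_operators" and zero': "(\<lambda>X. 0) = (\<lambda>X. 0 ** jones_e1 (0 ** X))"
    by (auto simp: mat_operators_def cscale_def vec_eq_iff)
  have FG0: "F (\<lambda>X. x ** jones_e1 (y ** X)) = G (\<lambda>X. x ** jones_e1 (y ** X))" for x y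
    using F G by (simp add: is_dual_cond_exp_def)
  have step: "(\<lambda>X. \<Sum>p\<in>A. T p X) \<in> mat_operators \<and> F (\<lambda>X. \<Sum>p\<in>A. T p X) = G (\<lambda>X. \<Sum>p\<in>A. T p X)"
    if "finite A" "\<forall>p. T p \<in> mat_operators \<and> F (T p) = G (T p)" for A and T :: "'b \<Rightarrow> _"
    using that(1)
  proof induction
    case empty
    show ?case
      using zero FG0 [of 0 0] by simp
  next
    case (insert p A)
    then show ?case
      using that(2) F G add by (simp add: is_dual_cond_exp_def)
  qed
  have Ssum: "S (\<Sum>p\<in>A. T p) = (\<Sum>p\<in>A. S (T p))" if "finite A" for A and T :: "'n \<times> 'n \<Rightarrow> _"
    using that
  proof induction
    case empty
    have "S (0 + 0) = S 0 + S 0"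
      using S unfolding mat_operators_def by blast
    then show ?case by simp
  next
    case (insert p A)
    then show ?case
      using S by (simp add: mat_operators_def)
  qed
  have tr: "trace (?U k j ** X) = X $ j $ k" for X :: "complex^'n^'n" and j k
  proof -
    have "(?U k j ** X) $ i $ i = (if i = k then X $ j $ i else 0)" for i
      by (auto simp: matrix_matrix_mult_def if_distrib [of "\<lambda>x. x * _"] cong: if_cong)
    then show ?thesis
      by (simp add: trace_def)
  qed
  have "S X = (\<Sum>p\<in>UNIV. ?R (fst p) (snd p) X)" for X
  proof -
    have "X = (\<Sum>p\<in>UNIV. (X $ fst p $ snd p) *\<^sub>C ?U (fst p) (snd p))"
    proof -
      have "(\<Sum>p\<in>UNIV. ((X $ fst p $ snd p) *\<^sub>C ?U (fst p) (snd p)) $ i $ j)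
          = (\<Sum>p\<in>UNIV. if p = (i, j) then X $ i $ j else 0)" for i j
        by (rule sum.cong) (auto simp: cscale_def)
      then show ?thesis
        by (simp add: vec_eq_iff)
    qed
    then have "S X = S (\<Sum>p\<in>UNIV. (X $ fst p $ snd p) *\<^sub>C ?U (fst p) (snd p))"
      by simp
    also have "\<dots> = (\<Sum>p\<in>UNIV. (X $ fst p $ snd p) *\<^sub>C S (?U (fst p) (snd p)))"
      using S by (simp add: Ssum) (simp add: mat_operators_def)
    also have "\<dots> = (\<Sum>p\<in>UNIV. ?R (fst p) (snd p) X)"
      by (simp only: jones_e1_eq mat_mult_right tr) (simp add: cscale_def vec_eq_iff)
    finally show ?thesis .
  qed
  then have "S = (\<lambda>X. \<Sum>p\<in>UNIV. ?R (fst p) (snd p) X)"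
    by blast
  moreover have "F (\<lambda>X. \<Sum>p\<in>UNIV. ?R (fst p) (snd p) X) = G (\<lambda>X. \<Sum>p\<in>UNIV. ?R (fst p) (snd p) X)"
    using step [of UNIV "\<lambda>p. ?R (fst p) (snd p)"] rk FG0 by simp
  ultimately show "F S = G S"
    by metis
qed

lemma dual_cond_exp_eqI: "is_dual_cond_exp F \<Longrightarrow> dual_cond_exp = F"
  unfolding dual_cond_exp_def using is_dual_cond_exp_unique by (metis the_equality)

end

theory Submission
  imports Defs
begin

text \<open>For $C = u\Delta u^*$ the Jones projection is $X \mapsto \sum_i p_i X p_i$ with
  $p_i = u e_{ii} u^*$. Writing $q_j = v e_{jj} v^*$ and $w = u^* v$, we have
  $p_i q_j = u (w_{ij} e_{ij}) v^*$ and $\mathrm{Tr}(p_i q_j) = |w_{ij}|^2$, so the dual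
  expectation of $(e_C - e_1)(e_D - e_1) = e_C e_D - e_1$ is $\frac1n u M v^*$ with
  $M = |w|^{\circ 2} \circ w - \frac1n w$; the case $u = v$ gives the norms.
  That the quotient is at most 1, so that the angle exists, is a Schur multiplier estimate:
  $|w_{ij}|^2 - \frac1n$ is the inner product of the vectors $(\delta_{ik} - \frac1n)_k$ and
  $(|w_{kj}|^2 - \frac1n)_k$, whose squared lengths are at most $1 - \frac1n$.\<close>

subsection \<open>The operator norm\<close>

lemma bounded_linear_matrix_vector:
  fixes A :: "complex^'n^'n"
  shows "bounded_linear (\<lambda>x. A *v x)"
proof -
  have "linear (\<lambda>x. A *v x)"
    by (rule linearI)
      (simp_all add: vec_eq_iff matrix_vector_mult_def sum.distrib algebra_simps scaleR_sum_right)
  then show ?thesis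
    by (simp add: linear_conv_bounded_linear)
qed

lemma norm_matrix_vector_le: "norm (A *v x) \<le> opnorm A * norm x"
  unfolding opnorm_def by (rule onorm [OF bounded_linear_matrix_vector])

lemma opnorm_nonneg: "0 \<le> opnorm A"
  unfolding opnorm_def by (rule onorm_pos_le [OF bounded_linear_matrix_vector])

lemma opnorm_cscale_of_real:
  fixes A :: "complex^'n^'n"
  shows "opnorm (complex_of_real r *\<^sub>C A) = \<bar>r\<bar> * opnorm A"
proof -
  have "(complex_of_real r *\<^sub>C A) *v x = r *\<^sub>R (A *v x)" for x
    by (simp add: vec_eq_iff matrix_vector_mult_def cscale_def)
      (simp add: scaleR_conv_of_real sum_distrib_left mult.assoc)
  then have "(\<lambda>x. (complex_of_real r *\<^sub>C A) *v x) = (\<lambda>x. r *\<^sub>R (A *v x))"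
    by (rule ext)
  then show ?thesis
    unfolding opnorm_def using onorm_scaleR [OF bounded_linear_matrix_vector, of r A] by simp
qed

lemma norm_vector_squared: "(norm x)\<^sup>2 = (\<Sum>i\<in>UNIV. (cmod (x $ i))\<^sup>2)" for x :: "complex^'n"
  by (simp add: norm_vec_def L2_set_def sum_nonneg)

lemma ctransp_mat_1: "ctransp (mat 1) = mat 1"
  by (simp add: ctransp_def mat_def vec_eq_iff)

text \<open>The squared norm of \<open>u *v x\<close> depends on \<open>u\<close> only through
  \<open>ctransp u ** u\<close>, so a unitary may be replaced by \<open>mat 1\<close>.\<close>

lemma norm_unitary_vector:
  fixes u :: "complex^'n^'n"
  assumes "unitary u"
  shows "norm (u *v x) = norm x"
proof -
  \<comment> \<open>\<open>u\<close> is bound afresh: the identity is needed both for the unitary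
    and for \<open>mat 1\<close>.\<close>
  have gram: "complex_of_real ((norm (u *v x))\<^sup>2) = (\<Sum>j\<in>UNIV. cnj (x $ j) * ((ctransp u ** u) *v x) $ j)"
    for u :: "complex^'n^'n"
  proof -
    have "complex_of_real ((norm (u *v x))\<^sup>2) = (\<Sum>i\<in>UNIV. cnj ((u *v x) $ i) * (u *v x) $ i)"
      unfolding norm_vector_squared of_real_sum complex_norm_square by (simp add: mult.commute)
    also have "\<dots> = (\<Sum>i\<in>UNIV. \<Sum>j\<in>UNIV. cnj (x $ j) * (cnj (u $ i $ j) * (u *v x) $ i))"
    proof -
      have "cnj ((u *v x) $ i) = (\<Sum>j\<in>UNIV. cnj (x $ j) * cnj (u $ i $ j))" for i
        by (simp add: matrix_vector_mult_def mult.commute)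
      then show ?thesis
        by (simp only: sum_distrib_right mult.assoc)
    qed
    also have "\<dots> = (\<Sum>j\<in>UNIV. cnj (x $ j) * (ctransp u *v (u *v x)) $ j)"
    proof -
      have "(ctransp u *v y) $ j = (\<Sum>i\<in>UNIV. cnj (u $ i $ j) * y $ i)" for y j
        by (simp add: matrix_vector_mult_def ctransp_def)
      then show ?thesis
        by (subst sum.swap) (simp add: sum_distrib_left)
    qed
    finally show ?thesis
      by (simp add: matrix_vector_mul_assoc)
  qed
  have "ctransp u ** u = ctransp (mat 1) ** mat 1"
    using assms by (simp add: unitary_def ctransp_mat_1)
  then have "complex_of_real ((norm (u *v x))\<^sup>2) = complex_of_real ((norm (mat 1 *v x))\<^sup>2)"
    unfolding gram by simp
  then have "(norm (u *v x))\<^sup>2 = (norm x)\<^sup>2"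
    by (simp only: of_real_eq_iff matrix_vector_mul_lid)
  then show ?thesis
    by (simp add: power2_eq_iff_nonneg)
qed

lemma unitary_ctransp: "unitary u \<Longrightarrow> unitary (ctransp u)"
  by (simp add: unitary_def)

lemma unitary_mult:
  assumes "unitary u" "unitary v"
  shows "unitary (u ** v)"
proof -
  have "ctransp (u ** v) ** (u ** v) = ctransp v ** (ctransp u ** u) ** v"
    "(u ** v) ** ctransp (u ** v) = u ** (v ** ctransp v) ** ctransp u"
    by (simp_all only: ctransp_mult matrix_mul_assoc)
  then show ?thesis
    using assms by (simp add: unitary_def)
qed

text \<open>Unitary factors cannot raise the norm; the reverse inequality is the same fact for the
  inverse unitaries, which recover \<open>A\<close>.\<close>

lemma opnorm_unitary_mult:
  fixes A u v :: "complex^'n^'n"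
  assumes "unitary u" "unitary v"
  shows "opnorm (u ** A ** v) = opnorm A"
proof (rule antisym)
  have le: "opnorm (u ** A ** v) \<le> opnorm A" if "unitary u" "unitary v" for A u v :: "complex^'n^'n"
  proof -
    have "norm ((u ** A ** v) *v x) \<le> opnorm A * norm x" for x
    proof -
      have "(u ** A ** v) *v x = u *v (A *v (v *v x))"
        by (simp add: matrix_vector_mul_assoc matrix_mul_assoc)
      then show ?thesis
        using norm_matrix_vector_le [of A "v *v x"] that by (simp add: norm_unitary_vector)
    qed
    then show ?thesis
      unfolding opnorm_def [of "u ** A ** v"] by (rule onorm_le)
  qed
  show "opnorm (u ** A ** v) \<le> opnorm A"
    using assms by (rule le)
  have "ctransp u ** (u ** A ** v) ** ctransp v = (ctransp u ** u) ** A ** (v ** ctransp v)"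
    by (simp only: matrix_mul_assoc)
  then have "ctransp u ** (u ** A ** v) ** ctransp v = A"
    using assms by (simp add: unitary_def)
  then show "opnorm A \<le> opnorm (u ** A ** v)"
    using le [OF assms [THEN unitary_ctransp], of "u ** A ** v"] by simp
qed

lemma opnorm_mat_1: "opnorm (mat 1 :: complex^'n^'n) = 1"
  unfolding opnorm_def matrix_vector_mul_lid by (rule onorm_id)

section \<open>Schur multipliers\<close>

text \<open>The matrix is the sum over \<open>k\<close> of \<open>w\<close> with its rows scaled by
  \<open>a i k\<close> and its columns by \<open>b j k\<close>. In the squared norm, Cauchy-Schwarz
  in \<open>k\<close>, row by row, costs one factor \<open>K\<close> (from \<open>a\<close>);
  bounding \<open>w\<close> for each \<open>k\<close> and summing over \<open>k\<close> costs
  another (from \<open>b\<close>).\<close>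

lemma opnorm_schur_multiplier_le:
  fixes w :: "complex^'n^'n" and a b :: "'n \<Rightarrow> 'k::finite \<Rightarrow> real"
  assumes a: "\<And>i. (\<Sum>k\<in>UNIV. (a i k)\<^sup>2) \<le> K" and b: "\<And>j. (\<Sum>k\<in>UNIV. (b j k)\<^sup>2) \<le> K"
  shows "opnorm (\<chi> i j. of_real (\<Sum>k\<in>UNIV. a i k * b j k) * w $ i $ j) \<le> K * opnorm w"
    (is "opnorm ?M \<le> _")
proof -
  have K: "0 \<le> K"
    using a by (meson order_trans sum_nonneg zero_le_power2)
  have "norm (?M *v y) \<le> K * opnorm w * norm y" for y
  proof -
    \<comment> \<open>The \<open>k\<close>-th summand applied to \<open>y\<close>, before its rows
      are scaled by \<open>a i k\<close>.\<close>
    define z where "z k = w *v (\<chi> j. of_real (b j k) * y $ j)" for k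
    have row: "(?M *v y) $ i = (\<Sum>k\<in>UNIV. of_real (a i k) * z k $ i)" for i
      by (simp add: matrix_vector_mult_def z_def sum_distrib_left sum_distrib_right mult_ac)
        (rule sum.swap)
    have "(cmod ((?M *v y) $ i))\<^sup>2 \<le> K * (\<Sum>k\<in>UNIV. (cmod (z k $ i))\<^sup>2)" for i
    proof -
      have "cmod ((?M *v y) $ i) \<le> (\<Sum>k\<in>UNIV. \<bar>a i k\<bar> * cmod (z k $ i))"
        unfolding row by (rule order_trans [OF norm_sum]) (simp add: norm_mult)
      then have "(cmod ((?M *v y) $ i))\<^sup>2 \<le> (\<Sum>k\<in>UNIV. \<bar>a i k\<bar> * cmod (z k $ i))\<^sup>2"
        by (rule power_mono) simp
      also have "\<dots> \<le> (\<Sum>k\<in>UNIV. \<bar>a i k\<bar>\<^sup>2) * (\<Sum>k\<in>UNIV. (cmod (z k $ i))\<^sup>2)"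
        by (rule Cauchy_Schwarz_ineq_sum)
      also have "\<dots> \<le> K * (\<Sum>k\<in>UNIV. (cmod (z k $ i))\<^sup>2)"
        using a [of i] by (intro mult_right_mono) (simp_all add: sum_nonneg)
      finally show ?thesis .
    qed
    then have "(norm (?M *v y))\<^sup>2 \<le> (\<Sum>i\<in>UNIV. K * (\<Sum>k\<in>UNIV. (cmod (z k $ i))\<^sup>2))"
      unfolding norm_vector_squared by (rule sum_mono)
    also have "\<dots> = K * (\<Sum>k\<in>UNIV. (norm (z k))\<^sup>2)"
      unfolding norm_vector_squared sum_distrib_left [symmetric] by (subst sum.swap) simp
    also have "\<dots> \<le> K * (\<Sum>k\<in>UNIV. (opnorm w)\<^sup>2 * (\<Sum>j\<in>UNIV. (b j k)\<^sup>2 * (cmod (y $ j))\<^sup>2))"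
    proof (intro mult_left_mono sum_mono K)
      fix k
      have "(norm (z k))\<^sup>2 \<le> (opnorm w * norm (\<chi> j. of_real (b j k) * y $ j))\<^sup>2"
        unfolding z_def by (intro power_mono norm_matrix_vector_le) simp
      then show "(norm (z k))\<^sup>2 \<le> (opnorm w)\<^sup>2 * (\<Sum>j\<in>UNIV. (b j k)\<^sup>2 * (cmod (y $ j))\<^sup>2)"
        by (simp add: power_mult_distrib norm_vector_squared norm_mult)
    qed
    \<comment> \<open>Exchanging the sums over \<open>k\<close> and \<open>j\<close> collects the
      squared length of \<open>b j\<close> in front of each \<open>y $ j\<close>.\<close>
    also have "\<dots> = K * (opnorm w)\<^sup>2 * (\<Sum>j\<in>UNIV. (\<Sum>k\<in>UNIV. (b j k)\<^sup>2) * (cmod (y $ j))\<^sup>2)"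
      unfolding sum_distrib_left [symmetric] sum_distrib_right mult.assoc by (subst sum.swap) simp
    also have "\<dots> \<le> K * (opnorm w)\<^sup>2 * (\<Sum>j\<in>UNIV. K * (cmod (y $ j))\<^sup>2)"
      using K by (intro mult_left_mono sum_mono mult_right_mono b) simp_all
    also have "\<dots> = (K * opnorm w * norm y)\<^sup>2"
      by (simp add: norm_vector_squared power_mult_distrib sum_distrib_left [symmetric] power2_eq_square [of K])
    finally show ?thesis
      by (rule power2_le_imp_le) (simp add: K opnorm_nonneg)
  qed
  then show ?thesis
    unfolding opnorm_def [of ?M] by (rule onorm_le)
qed

lemma opnorm_unitary:
  fixes u :: "complex^'n^'n"
  assumes "unitary u"
  shows "opnorm u = 1"
proof -
  have "unitary (mat 1 :: complex^'n^'n)"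
    by (simp add: unitary_def ctransp_mat_1)
  then show ?thesis
    using opnorm_unitary_mult [OF assms, of "mat 1" "mat 1"] by (simp add: opnorm_mat_1)
qed

lemma unitary_column_sum:
  fixes w :: "complex^'n^'n"
  assumes "unitary w"
  shows "(\<Sum>k\<in>UNIV. (cmod (w $ k $ j))\<^sup>2) = 1"
proof -
  have "(ctransp w ** w) $ j $ j = 1"
    using assms by (simp add: unitary_def mat_def)
  then have "complex_of_real (\<Sum>k\<in>UNIV. (cmod (w $ k $ j))\<^sup>2) = 1"
    by (simp only: ctransp_def matrix_matrix_mult_def vec_lambda_beta of_real_sum
        complex_norm_square mult.commute)
  then show ?thesis
    by (simp only: of_real_eq_1_iff)
qed

text \<open>The values have mean \<open>1 / n\<close>, so this is the variance identity: the cross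
  term contributes \<open>- 2 / n\<close> and the constant term \<open>1 / n\<close>.\<close>

lemma sum_squares_minus_mean:
  fixes c :: "'n::finite \<Rightarrow> real"
  assumes "(\<Sum>k\<in>UNIV. c k) = 1"
  shows "(\<Sum>k\<in>UNIV. (c k - 1 / real CARD('n))\<^sup>2) = (\<Sum>k\<in>UNIV. (c k)\<^sup>2) - 1 / real CARD('n)"
proof -
  have "(\<Sum>k\<in>UNIV. (c k - 1 / real CARD('n))\<^sup>2)
      = (\<Sum>k\<in>UNIV. (c k)\<^sup>2) + (\<Sum>k\<in>(UNIV::'n set). (1 / real CARD('n))\<^sup>2)
        - 2 * (1 / real CARD('n)) * (\<Sum>k\<in>UNIV. c k)"
    by (simp only: power2_diff sum_subtractf sum.distrib sum_distrib_left)
      (simp add: mult_ac)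
  moreover have "(\<Sum>k\<in>(UNIV::'n set). (1 / real CARD('n))\<^sup>2) = 1 / real CARD('n)"
    by (simp add: power2_eq_square)
  ultimately show ?thesis
    unfolding assms by linarith
qed

text \<open>\<open>a i\<close> is the \<open>i\<close>-th unit vector and \<open>b j\<close> the
  \<open>j\<close>-th column of \<open>abs_square w\<close>, both shifted to mean zero. Since
  \<open>b j\<close> sums to zero, shifting \<open>a i\<close> leaves the inner products unchanged,
  while it lowers its squared length from 1 to \<open>1 - 1 / n\<close>.\<close>

lemma opnorm_hadamard_unitary_le:
  fixes w :: "complex^'n^'n"
  assumes "unitary w"
  shows "opnorm (hadamard (abs_square w) w - (1 / of_nat CARD('n)) *\<^sub>C w) \<le> 1 - 1 / real CARD('n)"
proof -
  define a :: "'n \<Rightarrow> 'n \<Rightarrow> real" where "a i k = (if k = i then 1 else 0) - 1 / real CARD('n)" for i k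
  define b :: "'n \<Rightarrow> 'n \<Rightarrow> real" where "b j k = (cmod (w $ k $ j))\<^sup>2 - 1 / real CARD('n)" for j k
  have a: "(\<Sum>k\<in>UNIV. (a i k)\<^sup>2) \<le> 1 - 1 / real CARD('n)" for i
    unfolding a_def by (subst sum_squares_minus_mean) (simp_all add: if_distrib [of "\<lambda>x. x\<^sup>2"] cong: if_cong)
  have b: "(\<Sum>k\<in>UNIV. (b j k)\<^sup>2) \<le> 1 - 1 / real CARD('n)" for j
  proof -
    \<comment> \<open>Each squared modulus lies in [0, 1] because its column sums to 1, so squaring
      it once more cannot increase it.\<close>
    have "(cmod (w $ k $ j))\<^sup>2 \<le> 1" for k
      using member_le_sum [of k UNIV "\<lambda>k. (cmod (w $ k $ j))\<^sup>2"] by (simp add: unitary_column_sum [OF assms])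
    then have "((cmod (w $ k $ j))\<^sup>2)\<^sup>2 \<le> (cmod (w $ k $ j))\<^sup>2" for k
      using power_decreasing [of 1 2 "(cmod (w $ k $ j))\<^sup>2"] by simp
    then have "(\<Sum>k\<in>UNIV. ((cmod (w $ k $ j))\<^sup>2)\<^sup>2) \<le> 1"
      using sum_mono [of UNIV "\<lambda>k. ((cmod (w $ k $ j))\<^sup>2)\<^sup>2" "\<lambda>k. (cmod (w $ k $ j))\<^sup>2"]
      by (simp add: unitary_column_sum [OF assms])
    then show ?thesis
      unfolding b_def by (subst sum_squares_minus_mean) (simp_all add: unitary_column_sum [OF assms])
  qed
  have b0: "(\<Sum>k\<in>UNIV. b j k) = 0" for j
    by (simp add: b_def sum_subtractf unitary_column_sum [OF assms])
  have "(\<Sum>k\<in>UNIV. a i k * b j k) = (\<Sum>k\<in>UNIV. if k = i then b j k else 0) - (\<Sum>k\<in>UNIV. b j k) / real CARD('n)"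
    for i j
    unfolding sum_divide_distrib sum_subtractf [symmetric]
    by (rule sum.cong) (simp_all add: a_def left_diff_distrib)
  then have ab: "(\<Sum>k\<in>UNIV. a i k * b j k) = b j i" for i j
    by (simp add: b0)
  have "hadamard (abs_square w) w - (1 / of_nat CARD('n)) *\<^sub>C w
      = (\<chi> i j. of_real (\<Sum>k\<in>UNIV. a i k * b j k) * w $ i $ j)"
    unfolding ab by (simp add: vec_eq_iff hadamard_def abs_square_def cscale_def b_def algebra_simps)
  then show ?thesis
    using opnorm_schur_multiplier_le [of a _ b w, OF a b] by (simp add: opnorm_unitary [OF assms])
qed

subsection \<open>Jones projections\<close>

lemma trace_ctransp: "trace (ctransp A) = cnj (trace A)"
  by (simp add: trace_def ctransp_def)

lemma tau_inner_commute: "tau_inner X Y = cnj (tau_inner Y X)"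
proof -
  have "ctransp X ** Y = ctransp (ctransp Y ** X)"
    by (simp add: ctransp_mult)
  then show ?thesis
    unfolding tau_inner_def by (simp add: trace_ctransp)
qed

lemma trace_cond_exp_self_adjoint:
  assumes C: "unital_cstar_subalgebra C" and E: "trace_cond_exp C E"
  shows "tau_inner (E X) Y = tau_inner X (E Y)"
proof -
  have tr: "trace (c ** E X) = trace (c ** X)" if "c \<in> C" for c X
    using that C E unfolding trace_cond_exp_def unital_cstar_subalgebra_def by (metis matrix_mul_rid)
  have left: "tau_inner (E X) (E Y) = tau_inner (E X) Y" for X Y
    using C E unfolding tau_inner_def by (subst tr) (auto simp: trace_cond_exp_def unital_cstar_subalgebra_def)
  have "tau_inner (E X) Y = cnj (tau_inner (E Y) (E X))"
    by (subst tau_inner_commute [symmetric]) (rule left [symmetric])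
  also have "\<dots> = tau_inner X (E Y)"
    unfolding left by (rule tau_inner_commute [symmetric])
  finally show ?thesis .
qed

lemma trace_cond_exp_mat:
  fixes C :: "(complex^'n^'n) set"
  assumes C: "unital_cstar_subalgebra C" and E: "trace_cond_exp C E"
  shows "E (mat c) = mat c"
proof -
  have "c *\<^sub>C mat 1 \<in> C"
    using C by (simp add: unital_cstar_subalgebra_def)
  moreover have "c *\<^sub>C mat 1 = (mat c :: complex^'n^'n)"
    by (simp add: cscale_def mat_def vec_eq_iff)
  ultimately show ?thesis
    using E by (simp add: trace_cond_exp_def)
qed

lemma tau_inner_diff_left: "tau_inner (A - B) Y = tau_inner A Y - tau_inner B Y"
proof -
  have "ctransp (A - B) = ctransp A - ctransp B"
    by (simp add: ctransp_def vec_eq_iff)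
  then show ?thesis
    by (simp add: tau_inner_def mult_diff_left trace_sub diff_divide_distrib)
qed

lemma tau_inner_diff_right: "tau_inner X (A - B) = tau_inner X A - tau_inner X B"
  by (simp add: tau_inner_def mult_diff_right trace_sub diff_divide_distrib)

text \<open>Both differences are self-adjoint, and \<open>jones_e1\<close> absorbs \<open>E\<close>
  on its left and \<open>F\<close> on its right, so in the expanded product everything but
  \<open>E (F X)\<close> adds up to minus \<open>jones_e1 X\<close>. The scalar \<open>- 1\<close>
  fits the linearity clauses of \<open>is_dual_cond_exp\<close>.\<close>

lemma op_inner_jones_diff:
  fixes C D :: "(complex^'n^'n) set"
  assumes C: "unital_cstar_subalgebra C" and E: "trace_cond_exp C E"
    and D: "unital_cstar_subalgebra D" and F: "trace_cond_exp D F"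
  shows "op_inner (jones_diff C) (jones_diff D) = dual_cond_exp (\<lambda>X. E (F X) + (- 1) *\<^sub>C jones_e1 X)"
proof -
  have jC: "jones_diff C = (\<lambda>X. E X - jones_e1 X)" and jD: "jones_diff D = (\<lambda>X. F X - jones_e1 X)"
    unfolding jones_diff_def using jones_proj_eqI assms by metis+
  have e1: "tau_inner (jones_e1 X) Y = tau_inner X (jones_e1 Y)" for X Y :: "complex^'n^'n"
    unfolding jones_e1_eq
    by (rule trace_cond_exp_self_adjoint [OF unital_cstar_subalgebra_scalar trace_cond_exp_scalar])
  have "op_adjoint (jones_diff C) = jones_diff C"
    by (rule op_adjoint_unique)
      (simp add: jC tau_inner_diff_left tau_inner_diff_right e1 trace_cond_exp_self_adjoint [OF C E])
  moreover have "(jones_diff C \<circ> jones_diff D) X = E (F X) + (- 1) *\<^sub>C jones_e1 X" for X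
  proof -
    \<comment> \<open>Membership in \<open>mat_operators\<close> supplies additivity, from which the
      rule for a difference is read off.\<close>
    have "E ((F X - jones_e1 X) + jones_e1 X) = E (F X - jones_e1 X) + E (jones_e1 X)"
      using E unfolding trace_cond_exp_def mat_operators_def by blast
    then have Ed: "E (F X - jones_e1 X) = E (F X) - jones_e1 X"
      by (simp add: jones_e1_eq trace_cond_exp_mat [OF C E])
    \<comment> \<open>\<open>jones_e1\<close> sees only the trace, which \<open>F\<close> and
      \<open>jones_e1\<close> both preserve.\<close>
    have "trace (F X - jones_e1 X) = 0"
      using F by (simp add: trace_sub jones_e1_eq trace_cond_exp_def) (simp add: trace_def mat_def)
    then have "jones_e1 (F X - jones_e1 X) = 0"
      by (simp add: jones_e1_eq mat_def vec_eq_iff)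
    with Ed show ?thesis
      by (simp add: jC jD) (simp add: vec_eq_iff cscale_def)
  qed
  then have "jones_diff C \<circ> jones_diff D = (\<lambda>X. E (F X) + (- 1) *\<^sub>C jones_e1 X)"
    by blast
  ultimately show ?thesis
    by (simp add: op_inner_def)
qed

subsection \<open>The dual conditional expectation\<close>

lemma jones_e1_in_mat_operators: "jones_e1 \<in> (mat_operators :: (complex^'n^'n \<Rightarrow> _) set)"
  using trace_cond_exp_scalar unfolding jones_e1_eq trace_cond_exp_def by blast

lemma is_dual_cond_exp_dual_cond_exp: "is_dual_cond_exp dual_cond_exp"
  unfolding dual_cond_exp_eqI [OF ex_dual_cond_exp] by (rule ex_dual_cond_exp)

lemma dual_cond_exp_minus_e1:
  fixes S :: "complex^'n^'n \<Rightarrow> complex^'n^'n"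
  assumes "S \<in> mat_operators"
  shows "dual_cond_exp (\<lambda>X. S X + (- 1) *\<^sub>C jones_e1 X)
    = dual_cond_exp S - mat (1 / (of_nat CARD('n))\<^sup>2)"
proof -
  have F: "is_dual_cond_exp (dual_cond_exp :: _ \<Rightarrow> complex^'n^'n)"
    by (rule is_dual_cond_exp_dual_cond_exp)
  have "(\<lambda>X. (- 1) *\<^sub>C jones_e1 X) \<in> (mat_operators :: (complex^'n^'n \<Rightarrow> _) set)"
  proof -
    have "(- 1) *\<^sub>C c *\<^sub>C X = c *\<^sub>C (- 1) *\<^sub>C X" for c and X :: "complex^'n^'n"
      by (simp add: cscale_def)
    then show ?thesis
      using jones_e1_in_mat_operators [where 'n = 'n] by (simp add: mat_operators_def cscale_add)
  qed
  moreover have "dual_cond_exp (\<lambda>X. S X + T X) = dual_cond_exp S + dual_cond_exp T"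
    "dual_cond_exp (\<lambda>X. c *\<^sub>C S X) = c *\<^sub>C dual_cond_exp S"
    if "S \<in> mat_operators" "T \<in> mat_operators" for S T :: "complex^'n^'n \<Rightarrow> complex^'n^'n" and c
    using F that by (simp_all add: is_dual_cond_exp_def)
  ultimately have "dual_cond_exp (\<lambda>X. S X + (- 1) *\<^sub>C jones_e1 X)
      = dual_cond_exp S + (- 1) *\<^sub>C dual_cond_exp (jones_e1 :: complex^'n^'n \<Rightarrow> _)"
    using assms jones_e1_in_mat_operators [where 'n = 'n] by (simp only:)
  \<comment> \<open>The normalising clause at \<open>x = y = mat 1\<close> gives the value at
    \<open>jones_e1\<close> itself.\<close>
  moreover have "dual_cond_exp (\<lambda>X. mat 1 ** jones_e1 (mat 1 ** X))
      = (1 / (of_nat CARD('n))\<^sup>2) *\<^sub>C (mat 1 ** mat 1 :: complex^'n^'n)"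
    using F unfolding is_dual_cond_exp_def by blast
  then have "dual_cond_exp (jones_e1 :: complex^'n^'n \<Rightarrow> _) = (1 / (of_nat CARD('n))\<^sup>2) *\<^sub>C mat 1"
    by simp
  ultimately show ?thesis
    by (simp only:) (simp add: vec_eq_iff cscale_def mat_def)
qed

text \<open>With left and right multiplication read as a tensor product, this is the formula sending
  A tensor B to Tr(B) A / n. It follows from the explicit form of the dual expectation, which
  evaluates an operator at matrix units.\<close>

lemma dual_cond_exp_sandwich_sum:
  fixes A B :: "'k \<Rightarrow> complex^'n^'n"
  shows "(\<lambda>X. \<Sum>p\<in>P. A p ** X ** B p) \<in> mat_operators" (is "?S \<in> _")
    and "dual_cond_exp (\<lambda>X. \<Sum>p\<in>P. A p ** X ** B p)
      = (\<Sum>p\<in>P. (trace (B p) / of_nat CARD('n)) *\<^sub>C A p)"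
proof -
  let ?U = "\<lambda>j k. (\<chi> a b. if a = j \<and> b = k then 1 else 0) :: complex^'n^'n"
  have cs: "c *\<^sub>C (\<Sum>p\<in>P. T p) = (\<Sum>p\<in>P. c *\<^sub>C T p)" for c and T :: "'k \<Rightarrow> complex^'n^'n"
    by (simp add: vec_eq_iff cscale_def sum_distrib_left)
  show S: "?S \<in> mat_operators"
    by (simp add: mat_operators_def matrix_add_ldistrib mult_add_left sum.distrib
        cscale_mult_left cscale_mult_right cs)
  \<comment> \<open>\<open>?U j k\<close> is a matrix unit; setting \<open>l = k\<close> and summing
    over \<open>k\<close> turns the right factor into a trace.\<close>
  have U: "(M ** ?U j k ** N) $ i $ l = M $ i $ j * N $ k $ l" for M N :: "complex^'n^'n" and i j k l
  proof -
    have "(M ** ?U j k) $ i $ b = (if b = k then M $ i $ j else 0)" for b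
      by (auto simp: matrix_matrix_mult_def if_distrib [of "\<lambda>x. _ * x"] cong: if_cong)
    then show ?thesis
      by (simp add: matrix_matrix_mult_def [of "_ ** _"] if_distrib [of "\<lambda>x. x * _"] cong: if_cong)
  qed
  have "(\<Sum>k\<in>UNIV. ?S (?U j k) $ i $ k) = (\<Sum>p\<in>P. trace (B p) * A p $ i $ j)" for i j
    unfolding sum_component U by (subst sum.swap) (simp add: trace_def sum_distrib_left mult.commute)
  then show "dual_cond_exp ?S = (\<Sum>p\<in>P. (trace (B p) / of_nat CARD('n)) *\<^sub>C A p)"
    unfolding dual_cond_exp_eqI [OF ex_dual_cond_exp] restrict_apply' [OF S]
    by (simp add: vec_eq_iff cscale_def sum_divide_distrib)
qed

subsection \<open>Conjugates of the diagonal algebra\<close>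

text \<open>For unitary \<open>u\<close>, the rank-one projection \<open>u e_ii u*\<close> onto the
  line spanned by the \<open>i\<close>-th column.\<close>

definition column_proj :: "complex^'n^'n \<Rightarrow> 'n \<Rightarrow> complex^'n^'n"
  where "column_proj u i = (\<chi> a b. u $ a $ i * cnj (u $ b $ i))"

text \<open>Since \<open>p X p = (u* X u)_ii p\<close> for \<open>p = column_proj u i\<close>, the
  conjugated diagonal part is a sum of sandwiches, the form that the dual expectation
  handles.\<close>

lemma trace_cond_exp_column_proj:
  fixes u :: "complex^'n^'n"
  assumes "unitary u"
  shows "trace_cond_exp (conjugate_set u diagonal_matrices)
    (\<lambda>X. \<Sum>i\<in>UNIV. column_proj u i ** X ** column_proj u i)"
proof -
  have "u ** (\<chi> i j. if i = j then (ctransp u ** X ** u) $ i $ i else 0) ** ctransp u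
      = (\<Sum>i\<in>UNIV. column_proj u i ** X ** column_proj u i)" for X
  proof -
    have "(u ** (\<chi> i j. if i = j then M $ i $ i else 0)) $ a $ i = u $ a $ i * M $ i $ i"
      for M :: "complex^'n^'n" and a i
      by (simp add: matrix_matrix_mult_def if_distrib [of "\<lambda>x. _ * x"] cong: if_cong)
    then have L: "(u ** (\<chi> i j. if i = j then (ctransp u ** X ** u) $ i $ i else 0) ** ctransp u) $ a $ b
        = (\<Sum>i\<in>UNIV. u $ a $ i * (ctransp u ** X ** u) $ i $ i * cnj (u $ b $ i))" for a b
      by (simp add: matrix_matrix_mult_def [of "u ** _"] ctransp_def [of u])
    have "(column_proj u i ** X ** column_proj u i) $ a $ b
        = u $ a $ i * (ctransp u ** X ** u) $ i $ i * cnj (u $ b $ i)" for i a b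
      by (simp add: column_proj_def ctransp_def matrix_matrix_mult_def sum_distrib_left sum_distrib_right mult_ac)
    then show ?thesis
      by (simp add: vec_eq_iff L)
  qed
  then show ?thesis
    using trace_cond_exp_conjugate_diagonal [OF assms] by simp
qed

lemma column_proj_mult:
  "(column_proj u i ** column_proj v j) $ a $ b = u $ a $ i * (ctransp u ** v) $ i $ j * cnj (v $ b $ j)"
  by (simp add: column_proj_def ctransp_def matrix_matrix_mult_def sum_distrib_left sum_distrib_right mult_ac)

text \<open>The factors stand in the order in which they occur to the right of \<open>X\<close> in
  the composed expectations. Symmetry of the trace reverses them, and the sum along the diagonal is
  then an entry of \<open>ctransp u ** v\<close> times its conjugate.\<close>

lemma trace_column_proj_mult:
  "trace (column_proj v j ** column_proj u i) = of_real ((cmod ((ctransp u ** v) $ i $ j))\<^sup>2)"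
proof -
  have "trace (column_proj u i ** column_proj v j)
      = (ctransp u ** v) $ i $ j * (\<Sum>a\<in>UNIV. u $ a $ i * cnj (v $ a $ j))"
    by (simp add: trace_def column_proj_mult sum_distrib_left mult_ac)
  also have "(\<Sum>a\<in>UNIV. u $ a $ i * cnj (v $ a $ j)) = cnj ((ctransp u ** v) $ i $ j)"
    by (simp add: matrix_matrix_mult_def ctransp_def)
  finally show ?thesis
    by (subst trace_mul_sym) (simp only: complex_norm_square)
qed

text \<open>The composed expectations send \<open>X\<close> to the sum of
  \<open>p_i q_j X q_j p_i\<close>. The dual expectation keeps \<open>p_i q_j\<close>, weighted by
  the trace of \<open>q_j p_i\<close> over \<open>n\<close>; this weight is the Hadamard
  factor.\<close>

lemma op_inner_jones_diff_conjugate_diagonal: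
  fixes u v :: "complex^'n^'n"
  assumes u: "unitary u" and v: "unitary v"
  defines "w \<equiv> ctransp u ** v"
  shows "op_inner (jones_diff (conjugate_set u diagonal_matrices)) (jones_diff (conjugate_set v diagonal_matrices))
    = complex_of_real (1 / real CARD('n)) *\<^sub>C
        (u ** (hadamard (abs_square w) w - (1 / of_nat CARD('n)) *\<^sub>C w) ** ctransp v)"
    (is "?L = _ *\<^sub>C (u ** (?H - _) ** _)")
proof -
  let ?A = "\<lambda>(i, j). column_proj u i ** column_proj v j"
  let ?B = "\<lambda>(i, j). column_proj v j ** column_proj u i"
  let ?n = "of_nat CARD('n) :: complex"
  have sum_mult: "M ** (\<Sum>j\<in>UNIV. T j) ** N = (\<Sum>j\<in>UNIV. M ** T j ** N)"
    for M N :: "complex^'n^'n" and T :: "'n \<Rightarrow> _"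
  proof -
    have "linear (\<lambda>Y. M ** Y ** N)"
      by (rule linearI)
        (simp add: matrix_add_ldistrib mult_add_left,
          simp add: vec_eq_iff matrix_matrix_mult_def sum_distrib_left sum_distrib_right scaleR_sum_right)
    then show ?thesis
      by (rule linear_sum)
  qed
  have comp: "(\<Sum>i\<in>UNIV. column_proj u i ** (\<Sum>j\<in>UNIV. column_proj v j ** X ** column_proj v j) ** column_proj u i)
      = (\<Sum>p\<in>UNIV. ?A p ** X ** ?B p)" for X
  proof -
    have "(\<Sum>i\<in>UNIV. column_proj u i ** (\<Sum>j\<in>UNIV. column_proj v j ** X ** column_proj v j) ** column_proj u i)
        = (\<Sum>i\<in>UNIV. \<Sum>j\<in>UNIV. ?A (i, j) ** X ** ?B (i, j))"
      by (simp add: sum_mult matrix_mul_assoc)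
    then show ?thesis
      by (simp add: sum.cartesian_product case_prod_beta)
  qed
  have "?L = (\<Sum>p\<in>UNIV. (trace (?B p) / ?n) *\<^sub>C ?A p) - mat (1 / ?n\<^sup>2)"
    by (simp only: comp dual_cond_exp_minus_e1 [OF dual_cond_exp_sandwich_sum(1)]
        dual_cond_exp_sandwich_sum(2)
        op_inner_jones_diff [OF unital_cstar_subalgebra_conjugate_diagonal [OF u] trace_cond_exp_column_proj [OF u]
          unital_cstar_subalgebra_conjugate_diagonal [OF v] trace_cond_exp_column_proj [OF v]])
  moreover have "(\<Sum>p\<in>UNIV. (trace (?B p) / ?n) *\<^sub>C ?A p) = (1 / ?n) *\<^sub>C (u ** ?H ** ctransp v)"
  proof -
    have "(u ** ?H ** ctransp v) $ a $ b
        = (\<Sum>i\<in>UNIV. \<Sum>j\<in>UNIV. u $ a $ i * ?H $ i $ j * cnj (v $ b $ j))" for a b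
      by (subst sum.swap) (simp add: matrix_matrix_mult_def ctransp_def sum_distrib_right)
    moreover have "((trace (?B (i, j)) / ?n) *\<^sub>C ?A (i, j)) $ a $ b
        = 1 / ?n * (u $ a $ i * ?H $ i $ j * cnj (v $ b $ j))" for i j a b
      by (simp add: cscale_def trace_column_proj_mult column_proj_mult w_def hadamard_def abs_square_def)
    moreover have "(\<Sum>p\<in>UNIV. f p) = (\<Sum>i\<in>UNIV. \<Sum>j\<in>UNIV. f (i, j))" for f :: "'n \<times> 'n \<Rightarrow> complex"
      by (simp add: sum.cartesian_product)
    ultimately show ?thesis
      by (simp only: vec_eq_iff sum_component) (simp add: cscale_def sum_distrib_left)
  qed
  \<comment> \<open>The scalar left by \<open>jones_e1\<close> is also put between \<open>u\<close>
    and \<open>ctransp v\<close>: as \<open>u ** w ** ctransp v = mat 1\<close>, the identity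
    corresponds to \<open>w\<close>.\<close>
  moreover have "mat (1 / ?n\<^sup>2) = (1 / ?n) *\<^sub>C (u ** ((1 / ?n) *\<^sub>C w) ** ctransp v)"
  proof -
    have "u ** w ** ctransp v = (u ** ctransp u) ** (v ** ctransp v)"
      unfolding w_def by (simp only: matrix_mul_assoc)
    then have "u ** w ** ctransp v = mat 1"
      using u v by (simp add: unitary_def)
    then have "u ** ((1 / ?n) *\<^sub>C w) ** ctransp v = (1 / ?n) *\<^sub>C mat 1"
      by (simp add: cscale_mult_left cscale_mult_right)
    then show ?thesis
      by (simp add: cscale_def mat_def vec_eq_iff power2_eq_square)
  qed
  ultimately show ?thesis
    by (simp add: mult_diff_left mult_diff_right) (simp add: cscale_def vec_eq_iff algebra_simps)
qed

section \<open>Norms and the angle\<close>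

lemma op_norm_tilde_jones_diff_conjugate_diagonal:
  fixes u :: "complex^'n^'n"
  assumes u: "unitary u"
  shows "op_norm_tilde (jones_diff (conjugate_set u diagonal_matrices))
    = sqrt ((real CARD('n) - 1) / (real CARD('n))\<^sup>2)"
proof -
  have n: "real CARD('n) \<ge> 1"
    by (simp add: Suc_leI)
  \<comment> \<open>For \<open>v = u\<close> the matrix \<open>w\<close> is \<open>mat 1\<close>,
    and everything reduces to a scalar.\<close>
  have "hadamard (abs_square (mat 1)) (mat 1) - (1 / of_nat CARD('n)) *\<^sub>C mat 1
      = complex_of_real (1 - 1 / real CARD('n)) *\<^sub>C (mat 1 :: complex^'n^'n)"
    by (simp add: hadamard_def abs_square_def mat_def cscale_def vec_eq_iff)
  then have "op_inner (jones_diff (conjugate_set u diagonal_matrices)) (jones_diff (conjugate_set u diagonal_matrices))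
      = complex_of_real (1 / real CARD('n)) *\<^sub>C (u ** (complex_of_real (1 - 1 / real CARD('n)) *\<^sub>C mat 1) ** ctransp u)"
    using op_inner_jones_diff_conjugate_diagonal [OF u u] u by (simp add: unitary_def)
  then have "opnorm (op_inner (jones_diff (conjugate_set u diagonal_matrices)) (jones_diff (conjugate_set u diagonal_matrices)))
      = \<bar>1 / real CARD('n)\<bar> * (\<bar>1 - 1 / real CARD('n)\<bar> * opnorm (mat 1 :: complex^'n^'n))"
    by (simp only: opnorm_cscale_of_real opnorm_unitary_mult [OF u unitary_ctransp [OF u]])
  also have "\<dots> = (real CARD('n) - 1) / (real CARD('n))\<^sup>2"
    using n by (simp add: opnorm_mat_1 power2_eq_square field_simps)
  finally show ?thesis
    by (simp add: op_norm_tilde_def)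
qed

text \<open>The description in \<open>interior_angle\<close> denotes once the quotient lies in
  [0, 1]: \<open>arccos r\<close> is then in range, and cosine is injective there.\<close>

lemma cos_interior_angle:
  assumes "opnorm (op_inner (jones_diff C) (jones_diff D))
    / (op_norm_tilde (jones_diff C) * op_norm_tilde (jones_diff D)) = r" "0 \<le> r" "r \<le> 1"
  shows "cos (interior_angle C D) = r"
proof -
  have "interior_angle C D = arccos r"
    unfolding interior_angle_def assms(1)
  proof (rule the_equality)
    show "arccos r \<in> {0..pi / 2} \<and> cos (arccos r) = r"
      using assms arccos_le_pi2 [of r] arccos_lbound [of r] by simp
    show "a = arccos r" if "a \<in> {0..pi / 2} \<and> cos a = r" for a
      using that arccos_cos [of a] pi_ge_zero by auto
  qed
  then show ?thesis
    using assms by simp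
qed

theorem theoremE:
  fixes u v :: "complex^'n^'n"
  assumes "CARD('n) \<ge> 2"
    and "unitary u"
    and "unitary v"
  shows "cos (interior_angle (conjugate_set u diagonal_matrices) (conjugate_set v diagonal_matrices))
    = real CARD('n) / (real CARD('n) - 1) *
      opnorm (hadamard (abs_square (ctransp u ** v)) (ctransp u ** v)
              - (1 / of_nat CARD('n)) *\<^sub>C (ctransp u ** v))"
proof -
  let ?n = "real CARD('n)"
  define w where "w = ctransp u ** v"
  let ?M = "hadamard (abs_square w) w - (1 / of_nat CARD('n)) *\<^sub>C w"
  let ?C = "conjugate_set u diagonal_matrices" and ?D = "conjugate_set v diagonal_matrices"
  have n: "?n \<ge> 2"
    using assms(1) by simp
  have "unitary w"
    unfolding w_def using assms(2,3) by (intro unitary_mult unitary_ctransp)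
  then have M: "opnorm ?M \<le> 1 - 1 / ?n"
    by (rule opnorm_hadamard_unitary_le)
  \<comment> \<open>The outer unitaries do not change the operator norm, which leaves the factor
    \<open>1 / n\<close>.\<close>
  have inner: "opnorm (op_inner (jones_diff ?C) (jones_diff ?D)) = opnorm ?M / ?n"
    unfolding w_def op_inner_jones_diff_conjugate_diagonal [OF assms(2,3)] opnorm_cscale_of_real
      opnorm_unitary_mult [OF assms(2) unitary_ctransp [OF assms(3)]]
    by simp
  have norms: "op_norm_tilde (jones_diff ?C) * op_norm_tilde (jones_diff ?D) = (?n - 1) / ?n\<^sup>2"
    unfolding op_norm_tilde_jones_diff_conjugate_diagonal [OF assms(2)]
      op_norm_tilde_jones_diff_conjugate_diagonal [OF assms(3)]
    using n by simp
  have "opnorm (op_inner (jones_diff ?C) (jones_diff ?D))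
      / (op_norm_tilde (jones_diff ?C) * op_norm_tilde (jones_diff ?D)) = ?n / (?n - 1) * opnorm ?M"
    unfolding inner norms using n by (simp add: power2_eq_square)
  then have "cos (interior_angle ?C ?D) = ?n / (?n - 1) * opnorm ?M"
  proof (rule cos_interior_angle)
    show "0 \<le> ?n / (?n - 1) * opnorm ?M"
      using n opnorm_nonneg [of ?M] by simp
    \<comment> \<open>The Schur bound is exactly the reciprocal of the prefactor.\<close>
    have "?n / (?n - 1) * opnorm ?M \<le> ?n / (?n - 1) * (1 - 1 / ?n)"
      using n by (intro mult_left_mono M) simp
    also have "\<dots> = 1"
      using n by (simp add: field_simps)
    finally show "?n / (?n - 1) * opnorm ?M \<le> 1" .
  qed
  then show ?thesis
    by (simp add: w_def)
qed

end
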